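(* Let $\phi:\mathcal{H}\to\mathbb{C}$ be a nonzero Lie algebra homomorphism and let $M_\phi$ be the universal quasi-Whittaker module of type $\phi$ generated by the quasi-Whittaker vector $w$. If $w'\in M_\phi$ is a quasi-Whittaker vector of type $\phi$, then $w'\in\mathbb{C}[C]w$.
   Context: The Schrödinger algebra $\mathfrak{S}$ is the complex Lie algebra with basis $e,h,f,p,q,z$ and brackets $[h,e]=2e$, $[h,f]=-2f$, $[e,f]=h$, $[h,p]=p$, $[h,q]=-q$, $[p,q]=z$, $[e,q]=p$, $[p,f]=-q$, $[f,q]=0$, $[e,p]=0$, $[z,\mathfrak{S}]=0$. Its Heisenberg subalgebra is $\mathcal{H}=\mathrm{span}_{\mathbb{C}}\{p,q,z\}$. For a Lie algebra homomorphism $\phi:\mathcal{H}\to\mathbb{C}$ (so $\phi(z)=0$), a nonzero vector $v$ of an $\mathfrak{S}$-module is a quasi-Whittaker vector of type $\phi$ if $xv=\phi(x)v$ for all $x\in\mathcal{H}$. For $\phi\neq 0$, the universal quasi-Whittaker module of type $\phi$ is $M_\phi=\mathcal{U}(\mathfrak{S})\otimes_{\mathcal{U}(\mathcal{H})}\mathbb{C}_\phi$, where $\mathbb{C}_\phi=\mathbb{C}w$ is the one-dimensional $\mathcal{H}$-module with $xw=\phi(x)w$ for $x\in\mathcal{H}$; write $w$ also for its cyclic vector $1\otimes w$. Put $C=\phi(p)^2f-\phi(q)^2e-\phi(p)\phi(q)h\in\mathcal{U}(\mathfrak{S})$; $\mathbb{C}[C]$ is the subalgebra of $\mathcal{U}(\mathfrak{S})$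 generated by $C$, and $\mathbb{C}[C]w=\{a(C)w : a \text{ a complex polynomial}\}$. *)

theory Defs
  imports
    "HOL-Library.Poly_Mapping"
    "HOL-Computational_Algebra.Polynomial"
    "HOL-Computational_Algebra.Group_Closure"
begin

section \<open>Complex Lie algebras\<close>

class complex_lie_algebra = ab_group_add +
  fixes lie_scale :: "complex \<Rightarrow> 'a \<Rightarrow> 'a"  (infixr \<open>*\<^sub>L\<close> 75)
    and lie_bracket :: "'a \<Rightarrow> 'a \<Rightarrow> 'a"
  assumes lie_scale_right_distrib: "c *\<^sub>L (x + y) = c *\<^sub>L x + c *\<^sub>L y"
    and lie_scale_left_distrib: "(c + d) *\<^sub>L x = c *\<^sub>L x + d *\<^sub>L x"
    and lie_scale_scale: "c *\<^sub>L d *\<^sub>L x = (c * d) *\<^sub>L x"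
    and lie_scale_one: "1 *\<^sub>L x = x"
    and lie_bracket_add_left: "lie_bracket (x + y) u = lie_bracket x u + lie_bracket y u"
    and lie_bracket_scale_left: "lie_bracket (c *\<^sub>L x) u = c *\<^sub>L lie_bracket x u"
    and lie_bracket_self: "lie_bracket x x = 0"
    and lie_jacobi:
      "lie_bracket x (lie_bracket y u) + lie_bracket y (lie_bracket u x)
        + lie_bracket u (lie_bracket x y) = 0"

global_interpretation lie: vector_space "lie_scale :: complex \<Rightarrow> 'a \<Rightarrow> 'a::complex_lie_algebra"
  by standard (rule lie_scale_right_distrib lie_scale_left_distrib lie_scale_scale lie_scale_one)+

definition lie_hom :: "('g::complex_lie_algebra \<Rightarrow> 'h::complex_lie_algebra) \<Rightarrow> bool"
  where "lie_hom f \<longleftrightarrow>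
    (\<forall>x y. f (x + y) = f x + f y) \<and>
    (\<forall>c x. f (c *\<^sub>L x) = c *\<^sub>L f x) \<and>
    (\<forall>x y. f (lie_bracket x y) = lie_bracket (f x) (f y))"

text \<open>\<open>\<complex>\<close> is the one-dimensional abelian Lie algebra, the target of \<open>\<phi>\<close>.\<close>

instantiation complex :: complex_lie_algebra
begin

definition lie_scale_complex :: "complex \<Rightarrow> complex \<Rightarrow> complex"
  where "lie_scale_complex = (*)"

definition lie_bracket_complex :: "complex \<Rightarrow> complex \<Rightarrow> complex"
  where "lie_bracket_complex x y = 0"

instance
  by standard (simp_all add: lie_scale_complex_def lie_bracket_complex_def algebra_simps)

end


section \<open>The Schroedinger algebra and its Heisenberg subalgebra\<close>

text \<open>Elements are given by their coordinates with respect to the basis \<open>e, h, f, p, q, z\<close>;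
  the bracket is the bilinear extension of the table in \<open>schroedinger_brackets\<close> below.\<close>

datatype schroedinger =
  Schroedinger (ce: complex) (ch: complex) (cf: complex) (cp: complex) (cq: complex) (cz: complex)

instantiation schroedinger :: complex_lie_algebra
begin

definition zero_schroedinger :: schroedinger
  where "0 = Schroedinger 0 0 0 0 0 0"

definition plus_schroedinger :: "schroedinger \<Rightarrow> schroedinger \<Rightarrow> schroedinger"
  where "x + y = Schroedinger (ce x + ce y) (ch x + ch y) (cf x + cf y)
                              (cp x + cp y) (cq x + cq y) (cz x + cz y)"

definition uminus_schroedinger :: "schroedinger \<Rightarrow> schroedinger"
  where "- x = Schroedinger (- ce x) (- ch x) (- cf x) (- cp x) (- cq x) (- cz x)"

definition minus_schroedinger :: "schroedinger \<Rightarrow> schroedinger \<Rightarrow> schroedinger"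
  where "x - y = Schroedinger (ce x - ce y) (ch x - ch y) (cf x - cf y)
                              (cp x - cp y) (cq x - cq y) (cz x - cz y)"

definition lie_scale_schroedinger :: "complex \<Rightarrow> schroedinger \<Rightarrow> schroedinger"
  where "c *\<^sub>L x = Schroedinger (c * ce x) (c * ch x) (c * cf x) (c * cp x) (c * cq x) (c * cz x)"

definition lie_bracket_schroedinger :: "schroedinger \<Rightarrow> schroedinger \<Rightarrow> schroedinger"
  where "lie_bracket x y = Schroedinger
    (2 * (ch x * ce y - ce x * ch y))
    (ce x * cf y - cf x * ce y)
    (- 2 * (ch x * cf y - cf x * ch y))
    ((ch x * cp y - cp x * ch y) + (ce x * cq y - cq x * ce y))
    (- (ch x * cq y - cq x * ch y) - (cp x * cf y - cf x * cp y))
    (cp x * cq y - cq x * cp y)"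

instance
  by standard
    (simp_all add: zero_schroedinger_def plus_schroedinger_def uminus_schroedinger_def
      minus_schroedinger_def lie_scale_schroedinger_def lie_bracket_schroedinger_def algebra_simps)

end

definition sch_e :: schroedinger where "sch_e = Schroedinger 1 0 0 0 0 0"
definition sch_h :: schroedinger where "sch_h = Schroedinger 0 1 0 0 0 0"
definition sch_f :: schroedinger where "sch_f = Schroedinger 0 0 1 0 0 0"
definition sch_p :: schroedinger where "sch_p = Schroedinger 0 0 0 1 0 0"
definition sch_q :: schroedinger where "sch_q = Schroedinger 0 0 0 0 1 0"
definition sch_z :: schroedinger where "sch_z = Schroedinger 0 0 0 0 0 1"

lemmas schroedinger_defs =
  zero_schroedinger_def plus_schroedinger_def uminus_schroedinger_def minus_schroedinger_def
  lie_scale_schroedinger_def lie_bracket_schroedinger_def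
  sch_e_def sch_h_def sch_f_def sch_p_def sch_q_def sch_z_def

lemma schroedinger_basis_expansion:
  "x = ce x *\<^sub>L sch_e + ch x *\<^sub>L sch_h + cf x *\<^sub>L sch_f
     + cp x *\<^sub>L sch_p + cq x *\<^sub>L sch_q + cz x *\<^sub>L sch_z"
  by (simp add: schroedinger_defs)

lemma schroedinger_brackets:
  "lie_bracket sch_h sch_e = 2 *\<^sub>L sch_e"
  "lie_bracket sch_h sch_f = (- 2) *\<^sub>L sch_f"
  "lie_bracket sch_e sch_f = sch_h"
  "lie_bracket sch_h sch_p = sch_p"
  "lie_bracket sch_h sch_q = - sch_q"
  "lie_bracket sch_p sch_q = sch_z"
  "lie_bracket sch_e sch_q = sch_p"
  "lie_bracket sch_p sch_f = - sch_q"
  "lie_bracket sch_f sch_q = 0"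
  "lie_bracket sch_e sch_p = 0"
  "lie_bracket sch_z x = 0"
  by (simp_all add: schroedinger_defs)

typedef heisenberg = "lie.span {sch_p, sch_q, sch_z}"
  morphisms heis_incl Abs_heisenberg
  using lie.span_zero by blast

setup_lifting type_definition_heisenberg

lemma heisenberg_span_iff:
  "x \<in> lie.span {sch_p, sch_q, sch_z} \<longleftrightarrow> ce x = 0 \<and> ch x = 0 \<and> cf x = 0"
proof
  assume "x \<in> lie.span {sch_p, sch_q, sch_z}"
  then show "ce x = 0 \<and> ch x = 0 \<and> cf x = 0"
    by (induction rule: lie.span_induct_alt) (auto simp: schroedinger_defs)
next
  assume "ce x = 0 \<and> ch x = 0 \<and> cf x = 0"
  then have "x = cp x *\<^sub>L sch_p + cq x *\<^sub>L sch_q + cz x *\<^sub>L sch_z"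
    by (cases x) (simp add: schroedinger_defs)
  moreover have "cp x *\<^sub>L sch_p + cq x *\<^sub>L sch_q + cz x *\<^sub>L sch_z
      \<in> lie.span {sch_p, sch_q, sch_z}"
    by (intro lie.span_add lie.span_scale lie.span_base) auto
  ultimately show "x \<in> lie.span {sch_p, sch_q, sch_z}" by simp
qed

instantiation heisenberg :: complex_lie_algebra
begin

lift_definition zero_heisenberg :: heisenberg is 0 by (rule lie.span_zero)
lift_definition plus_heisenberg :: "heisenberg \<Rightarrow> heisenberg \<Rightarrow> heisenberg" is "(+)"
  by (rule lie.span_add)
lift_definition uminus_heisenberg :: "heisenberg \<Rightarrow> heisenberg" is uminus
  by (rule lie.span_neg)
lift_definition minus_heisenberg :: "heisenberg \<Rightarrow> heisenberg \<Rightarrow> heisenberg" is "(-)"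
  by (rule lie.span_diff)
lift_definition lie_scale_heisenberg :: "complex \<Rightarrow> heisenberg \<Rightarrow> heisenberg" is "(*\<^sub>L)"
  by (rule lie.span_scale)
lift_definition lie_bracket_heisenberg :: "heisenberg \<Rightarrow> heisenberg \<Rightarrow> heisenberg" is lie_bracket
  unfolding heisenberg_span_iff by (simp add: lie_bracket_schroedinger_def)

instance
proof
  fix c d :: complex and x y u :: heisenberg
  show "c *\<^sub>L (x + y) = c *\<^sub>L x + c *\<^sub>L y" by transfer (rule lie_scale_right_distrib)
  show "(c + d) *\<^sub>L x = c *\<^sub>L x + d *\<^sub>L x" by transfer (rule lie_scale_left_distrib)
  show "c *\<^sub>L d *\<^sub>L x = (c * d) *\<^sub>L x" by transfer (rule lie_scale_scale)
  show "1 *\<^sub>L x = x" by transfer (rule lie_scale_one)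
  show "lie_bracket (x + y) u = lie_bracket x u + lie_bracket y u"
    by transfer (rule lie_bracket_add_left)
  show "lie_bracket (c *\<^sub>L x) u = c *\<^sub>L lie_bracket x u"
    by transfer (rule lie_bracket_scale_left)
  show "lie_bracket x x = 0" by transfer (rule lie_bracket_self)
  show "lie_bracket x (lie_bracket y u) + lie_bracket y (lie_bracket u x)
      + lie_bracket u (lie_bracket x y) = 0" by transfer (rule lie_jacobi)
qed (transfer; simp)+

end

lift_definition heis_p :: heisenberg is sch_p by (rule lie.span_base) simp
lift_definition heis_q :: heisenberg is sch_q by (rule lie.span_base) simp
lift_definition heis_z :: heisenberg is sch_z by (rule lie.span_base) simp

lemma lie_hom_heis_incl: "lie_hom heis_incl"
  unfolding lie_hom_def
  by (simp add: plus_heisenberg.rep_eq lie_scale_heisenberg.rep_eq lie_bracket_heisenberg.rep_eq)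


section \<open>Free algebras\<close>

datatype 'a word = Word (letters: "'a list")

text \<open>The additive notation for concatenation makes the product of \<^type>\<open>poly_mapping\<close>
  the convolution product of the monoid algebra \<open>\<complex>[words]\<close>, i.e. of the free algebra.\<close>

instantiation word :: (type) monoid_add
begin

definition zero_word :: "'a word"
  where "0 = Word []"

definition plus_word :: "'a word \<Rightarrow> 'a word \<Rightarrow> 'a word"
  where "v + w = Word (letters v @ letters w)"

instance
  by standard (simp_all add: zero_word_def plus_word_def)

end

type_synonym 'g free_algebra = "'g word \<Rightarrow>\<^sub>0 complex"

definition fa_gen :: "'g \<Rightarrow> 'g free_algebra"
  where "fa_gen x = Poly_Mapping.single (Word [x]) 1"

definition fa_const :: "complex \<Rightarrow> 'g free_algebra"
  where "fa_const c = Poly_Mapping.single 0 c"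

text \<open>Extension of \<open>f\<close> to the free algebra, with values in a ring whose
  \<open>\<complex>\<close>-algebra structure is given by \<open>s\<close>.\<close>

definition fa_lift :: "(complex \<Rightarrow> 'r::ring_1) \<Rightarrow> ('g \<Rightarrow> 'r) \<Rightarrow> 'g free_algebra \<Rightarrow> 'r"
  where "fa_lift s f a =
    (\<Sum>w\<in>Poly_Mapping.keys a. s (Poly_Mapping.lookup a w) * prod_list (map f (letters w)))"

lemma free_algebra_induct [case_names single add]:
  assumes "\<And>w c. P (Poly_Mapping.single w c)" and "\<And>a b. P a \<Longrightarrow> P b \<Longrightarrow> P (a + b)"
  shows "P (a :: 'g free_algebra)"
proof (induction a rule: update_induct)
  case const
  show ?case using assms(1)[of undefined 0] by simp
next
  case (update a w c)
  have "Poly_Mapping.update w c a = a + Poly_Mapping.single w c"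
    using update(1)
    by (intro poly_mapping_eqI)
      (auto simp: lookup_update lookup_add lookup_single when_def in_keys_iff)
  with update(3) assms show ?case by simp
qed

locale algebra_data =
  fixes s :: "complex \<Rightarrow> 'r::ring_1" and f :: "'g \<Rightarrow> 'r"
  assumes s_add: "s (c + d) = s c + s d"
    and s_mult: "s (c * d) = s c * s d"
    and s_one: "s 1 = 1"
    and s_central: "s c * f x = f x * s c"
begin

lemma s_zero: "s 0 = 0"
  using s_add[of 0 0] by simp

lemma s_central_prod: "prod_list (map f xs) * s c = s c * prod_list (map f xs)"
  proof (induction xs)
  case (Cons x xs)
  have "f x * prod_list (map f xs) * s c = f x * s c * prod_list (map f xs)"
    by (simp only: mult.assoc Cons.IH)
  also have "\<dots> = s c * (f x * prod_list (map f xs))"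
    by (simp only: mult.assoc flip: s_central)
  finally show ?case by simp
qed simp

lemma fa_lift_superset:
  assumes "finite A" "Poly_Mapping.keys a \<subseteq> A"
  shows "fa_lift s f a = (\<Sum>w\<in>A. s (Poly_Mapping.lookup a w) * prod_list (map f (letters w)))"
  unfolding fa_lift_def using assms
  by (intro sum.mono_neutral_left) (auto simp: in_keys_iff s_zero)

lemma fa_lift_single:
  "fa_lift s f (Poly_Mapping.single w c) = s c * prod_list (map f (letters w))"
  by (subst fa_lift_superset[of "{w}"]) auto

lemma fa_lift_add: "fa_lift s f (a + b) = fa_lift s f a + fa_lift s f b"
proof -
  let ?A = "Poly_Mapping.keys a \<union> Poly_Mapping.keys b"
  have "Poly_Mapping.keys (a + b) \<subseteq> ?A" by (rule Poly_Mapping.keys_add)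
  then show ?thesis
    by (simp add: fa_lift_superset[of ?A] lookup_add s_add distrib_right sum.distrib)
qed

lemma fa_lift_zero: "fa_lift s f 0 = 0"
  by (simp add: fa_lift_def)

lemma fa_lift_diff: "fa_lift s f (a - b) = fa_lift s f a - fa_lift s f b"
  using fa_lift_add[of "a - b" b] by simp

lemma fa_lift_mult: "fa_lift s f (a * b) = fa_lift s f a * fa_lift s f b"
proof (induction a rule: free_algebra_induct)
  case (single v c)
  show ?case
  proof (induction b rule: free_algebra_induct)
    case (single w d)
    let ?v = "prod_list (map f (letters v))" and ?w = "prod_list (map f (letters w))"
    have "s (c * d) * (?v * ?w) = s c * (s d * ?v) * ?w"
      by (simp only: s_mult mult.assoc)
    also have "\<dots> = s c * ?v * (s d * ?w)"
      by (simp only: s_central_prod[of "letters v" d, symmetric] mult.assoc)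
    finally have "s (c * d) * (?v * ?w) = s c * ?v * (s d * ?w)" .
    then show ?case by (simp add: mult_single fa_lift_single plus_word_def)
  next
    case (add a b)
    then show ?case by (simp add: distrib_left fa_lift_add)
  qed
next
  case (add a b)
  then show ?case by (simp add: distrib_right fa_lift_add)
qed

lemma fa_lift_const: "fa_lift s f (fa_const c) = s c"
  by (simp add: fa_const_def fa_lift_single zero_word_def)

lemma fa_lift_gen: "fa_lift s f (fa_gen x) = f x"
  by (simp add: fa_gen_def fa_lift_single s_one)

end


section \<open>Universal enveloping algebras\<close>

text \<open>The first two families of relations turn the free algebra on the underlying set of
  \<open>\<gg>\<close> into the tensor algebra of the vector space \<open>\<gg>\<close>.\<close>

definition uea_relations :: "'g::complex_lie_algebra free_algebra set"
  where "uea_relations =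
    {fa_gen (x + y) - (fa_gen x + fa_gen y) | x y. True}
    \<union> {fa_gen (c *\<^sub>L x) - fa_const c * fa_gen x | c x. True}
    \<union> {fa_gen x * fa_gen y - fa_gen y * fa_gen x - fa_gen (lie_bracket x y) | x y. True}"

definition uea_ideal :: "'g::complex_lie_algebra free_algebra set"
  where "uea_ideal = group_closure {a * r * b | a r b. r \<in> uea_relations}"

lemma uea_ideal_add: "a \<in> uea_ideal \<Longrightarrow> b \<in> uea_ideal \<Longrightarrow> a + b \<in> uea_ideal"
  unfolding uea_ideal_def by (rule group_closure_add)

lemma uea_ideal_minus: "a \<in> uea_ideal \<Longrightarrow> - a \<in> uea_ideal"
  unfolding uea_ideal_def by simp

lemma uea_ideal_mult_left:
  assumes "x \<in> uea_ideal"
  shows "y * x \<in> uea_ideal"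
  using assms unfolding uea_ideal_def
proof (induction rule: group_closure.induct)
  case (base x)
  then consider "x = 0" | a r b where "x = a * r * b" "r \<in> uea_relations" by blast
  then show ?case
  proof cases
    case 2
    then have "y * x = (y * a) * r * b" by (simp add: mult.assoc)
    with 2 show ?thesis by (intro group_closure.base) blast
  qed simp
next
  case (diff a c)
  then show ?case by (simp add: right_diff_distrib group_closure.diff)
qed

lemma uea_ideal_mult_right:
  assumes "x \<in> uea_ideal"
  shows "x * y \<in> uea_ideal"
  using assms unfolding uea_ideal_def
proof (induction rule: group_closure.induct)
  case (base x)
  then consider "x = 0" | a r b where "x = a * r * b" "r \<in> uea_relations" by blast
  then show ?case
  proof cases
    case 2
    then have "x * y = a * r * (b * y)" by (simp add: mult.assoc)
    with 2 show ?thesis by (intro group_closure.base) blast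
  qed simp
next
  case (diff a c)
  then show ?case by (simp add: left_diff_distrib group_closure.diff)
qed

text \<open>\<open>f\<close> is an algebra map out of \<open>U(\<gg>)\<close> on generators.\<close>

locale uea_data = algebra_data s f
  for s :: "complex \<Rightarrow> 'r::ring_1" and f :: "'g::complex_lie_algebra \<Rightarrow> 'r" +
  assumes f_add: "f (x + y) = f x + f y"
    and f_scale: "f (c *\<^sub>L x) = s c * f x"
    and f_bracket: "f (lie_bracket x y) = f x * f y - f y * f x"
begin

lemma fa_lift_relation: "r \<in> uea_relations \<Longrightarrow> fa_lift s f r = 0"
  unfolding uea_relations_def
  by (auto simp: fa_lift_add fa_lift_diff fa_lift_mult fa_lift_gen fa_lift_const
      f_add f_scale f_bracket)

lemma fa_lift_ideal: "a \<in> uea_ideal \<Longrightarrow> fa_lift s f a = 0"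
  unfolding uea_ideal_def
  by (induction rule: group_closure.induct)
    (auto simp: fa_lift_diff fa_lift_mult fa_lift_relation fa_lift_zero)

end

quotient_type (overloaded) 'g uea =
  "'g::complex_lie_algebra free_algebra" / "\<lambda>a b. a - b \<in> uea_ideal"
  morphisms rep_uea abs_uea
proof (rule equivpI)
  show "reflp (\<lambda>a b :: 'g free_algebra. a - b \<in> uea_ideal)"
    by (simp add: reflp_def uea_ideal_def)
  show "symp (\<lambda>a b :: 'g free_algebra. a - b \<in> uea_ideal)"
    using uea_ideal_minus by (fastforce simp: symp_def)
  show "transp (\<lambda>a b :: 'g free_algebra. a - b \<in> uea_ideal)"
  proof (rule transpI)
    fix a b c :: "'g free_algebra"
    assume "a - b \<in> uea_ideal" "b - c \<in> uea_ideal"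
    from uea_ideal_add[OF this] show "a - c \<in> uea_ideal" by simp
  qed
qed

instantiation uea :: (complex_lie_algebra) ring_1
begin

lift_definition zero_uea :: "'a uea" is 0 .
lift_definition one_uea :: "'a uea" is 1 .
lift_definition plus_uea :: "'a uea \<Rightarrow> 'a uea \<Rightarrow> 'a uea" is "(+)"
proof -
  fix a a' b b' :: "'a free_algebra"
  assume "a - a' \<in> uea_ideal" "b - b' \<in> uea_ideal"
  then have "(a - a') + (b - b') \<in> uea_ideal" by (rule uea_ideal_add)
  then show "a + b - (a' + b') \<in> uea_ideal" by (simp add: algebra_simps)
qed
lift_definition uminus_uea :: "'a uea \<Rightarrow> 'a uea" is uminus
  using uea_ideal_minus by fastforce
lift_definition minus_uea :: "'a uea \<Rightarrow> 'a uea \<Rightarrow> 'a uea" is "(-)"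
proof -
  fix a a' b b' :: "'a free_algebra"
  assume "a - a' \<in> uea_ideal" "b - b' \<in> uea_ideal"
  then have "(a - a') + - (b - b') \<in> uea_ideal" by (intro uea_ideal_add uea_ideal_minus)
  then show "a - b - (a' - b') \<in> uea_ideal" by (simp add: algebra_simps)
qed
lift_definition times_uea :: "'a uea \<Rightarrow> 'a uea \<Rightarrow> 'a uea" is "(*)"
proof -
  fix a a' b b' :: "'a free_algebra"
  assume "a - a' \<in> uea_ideal" "b - b' \<in> uea_ideal"
  then have "(a - a') * b + a' * (b - b') \<in> uea_ideal"
    by (intro uea_ideal_add uea_ideal_mult_left uea_ideal_mult_right)
  then show "a * b - a' * b' \<in> uea_ideal" by (simp add: algebra_simps)
qed

lemma one_notin_uea_ideal: "(1 :: 'a free_algebra) \<notin> uea_ideal"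
proof
  interpret uea_data "id :: complex \<Rightarrow> complex" "\<lambda>_ :: 'a. 0"
    by standard simp_all
  assume "(1 :: 'a free_algebra) \<in> uea_ideal"
  from fa_lift_ideal[OF this] show False
    using fa_lift_const[of 1] by (simp add: fa_const_def)
qed

instance
proof
  fix a b c :: "'a uea"
  have zero: "(0 :: 'a free_algebra) \<in> uea_ideal"
    by (simp add: uea_ideal_def)
  show "a * b * c = a * (b * c)" by transfer (simp add: mult.assoc zero)
  show "a + b + c = a + (b + c)" by transfer (simp add: add.assoc zero)
  show "a + b = b + a" by transfer (simp add: add.commute zero)
  show "0 + a = a" by transfer (simp add: zero)
  show "- a + a = 0" by transfer (simp add: zero)
  show "a - b = a + - b" by transfer (simp add: zero)
  show "1 * a = a" by transfer (simp add: zero)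
  show "a * 1 = a" by transfer (simp add: zero)
  show "(a + b) * c = a * c + b * c" by transfer (simp add: distrib_right zero)
  show "a * (b + c) = a * b + a * c" by transfer (simp add: distrib_left zero)
  show "(0 :: 'a uea) \<noteq> 1"
  proof (transfer, rule notI)
    assume "(0 :: 'a free_algebra) - 1 \<in> uea_ideal"
    from uea_ideal_minus[OF this] show False using one_notin_uea_ideal by simp
  qed
qed

end

lift_definition uea_gen :: "'g::complex_lie_algebra \<Rightarrow> 'g uea" is fa_gen .

lift_definition uea_scalar :: "complex \<Rightarrow> 'g::complex_lie_algebra uea" is fa_const .

text \<open>The homomorphism out of \<open>U(\<gg>)\<close> extending \<open>f\<close>. The choice of representative is
  irrelevant as soon as \<open>f\<close> respects the relations, see \<open>uea_lift_abs\<close>.\<close>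

definition uea_lift ::
    "(complex \<Rightarrow> 'r::ring_1) \<Rightarrow> ('g::complex_lie_algebra \<Rightarrow> 'r) \<Rightarrow> 'g uea \<Rightarrow> 'r"
  where "uea_lift s f u = fa_lift s f (rep_uea u)"

context uea_data
begin

lemma uea_lift_abs: "uea_lift s f (abs_uea a) = fa_lift s f a"
proof -
  have "rep_uea (abs_uea a) - a \<in> uea_ideal"
    by (rule Quotient3_rep_abs[OF Quotient3_uea]) (simp add: uea_ideal_def)
  from fa_lift_ideal[OF this] show ?thesis
    by (simp add: uea_lift_def fa_lift_diff)
qed

lemma uea_lift_add: "uea_lift s f (u + v) = uea_lift s f u + uea_lift s f v"
  by (induction u rule: uea.abs_induct, induction v rule: uea.abs_induct)
    (simp add: plus_uea.abs_eq uea_lift_abs fa_lift_add)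

lemma uea_lift_mult: "uea_lift s f (u * v) = uea_lift s f u * uea_lift s f v"
  by (induction u rule: uea.abs_induct, induction v rule: uea.abs_induct)
    (simp add: times_uea.abs_eq uea_lift_abs fa_lift_mult)

lemma uea_lift_gen: "uea_lift s f (uea_gen x) = f x"
  by (simp add: uea_gen.abs_eq uea_lift_abs fa_lift_gen)

lemma uea_lift_scalar: "uea_lift s f (uea_scalar c) = s c"
  by (simp add: uea_scalar.abs_eq uea_lift_abs fa_lift_const)

end

text \<open>The functor \<open>U\<close> on morphisms.\<close>

definition uea_map ::
    "('g::complex_lie_algebra \<Rightarrow> 'h::complex_lie_algebra) \<Rightarrow> 'g uea \<Rightarrow> 'h uea"
  where "uea_map f = uea_lift uea_scalar (\<lambda>x. uea_gen (f x))"

definition uea_poly :: "complex poly \<Rightarrow> 'g::complex_lie_algebra uea \<Rightarrow> 'g uea"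
  where "uea_poly a u = (\<Sum>i\<le>degree a. uea_scalar (coeff a i) * u ^ i)"

lemma uea_gen_add: "uea_gen (x + y) = uea_gen x + uea_gen y"
proof (transfer)
  fix x y :: "'g::complex_lie_algebra"
  have "1 * (fa_gen (x + y) - (fa_gen x + fa_gen y)) * 1 \<in> uea_ideal"
    unfolding uea_ideal_def uea_relations_def by (intro group_closure.base) blast
  then show "fa_gen (x + y) - (fa_gen x + fa_gen y) \<in> uea_ideal" by simp
qed

lemma uea_gen_scale: "uea_gen (c *\<^sub>L x) = uea_scalar c * uea_gen x"
proof (transfer)
  fix c and x :: "'g::complex_lie_algebra"
  have "1 * (fa_gen (c *\<^sub>L x) - fa_const c * fa_gen x) * 1 \<in> uea_ideal"
    unfolding uea_ideal_def uea_relations_def by (intro group_closure.base) blast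
  then show "fa_gen (c *\<^sub>L x) - fa_const c * fa_gen x \<in> uea_ideal" by simp
qed

lemma uea_gen_bracket:
  "uea_gen (lie_bracket x y) = uea_gen x * uea_gen y - uea_gen y * uea_gen x"
proof (rule sym, transfer)
  fix x y :: "'g::complex_lie_algebra"
  have "1 * (fa_gen x * fa_gen y - fa_gen y * fa_gen x - fa_gen (lie_bracket x y)) * 1
      \<in> uea_ideal"
    unfolding uea_ideal_def uea_relations_def by (intro group_closure.base) blast
  then show "fa_gen x * fa_gen y - fa_gen y * fa_gen x - fa_gen (lie_bracket x y) \<in> uea_ideal"
    by simp
qed

lemma uea_scalar_add: "uea_scalar (c + d) = uea_scalar c + uea_scalar d"
  by transfer (simp add: fa_const_def single_add uea_ideal_def)

lemma uea_scalar_mult: "uea_scalar (c * d) = uea_scalar c * uea_scalar d"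
  by transfer (simp add: fa_const_def mult_single uea_ideal_def)

lemma uea_scalar_one: "uea_scalar 1 = 1"
  by transfer (simp add: fa_const_def uea_ideal_def)

lemma uea_scalar_gen: "uea_scalar c * uea_gen x = uea_gen x * uea_scalar c"
  by transfer (simp add: fa_const_def fa_gen_def mult_single uea_ideal_def)

lemma uea_data_map: "lie_hom f \<Longrightarrow> uea_data uea_scalar (\<lambda>x. uea_gen (f x))"
  unfolding lie_hom_def
  by standard (simp_all add: uea_scalar_add uea_scalar_mult uea_scalar_one uea_scalar_gen
      uea_gen_add uea_gen_scale uea_gen_bracket)

lemma uea_data_character: "lie_hom \<phi> \<Longrightarrow> uea_data id (\<phi> :: 'g::complex_lie_algebra \<Rightarrow> complex)"
  unfolding lie_hom_def
  by standard (simp_all add: lie_scale_complex_def lie_bracket_complex_def)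


section \<open>Modules and extension of scalars\<close>

record ('r, 'm) left_module =
  mcarrier :: "'m set"
  mzero :: 'm
  madd :: "'m \<Rightarrow> 'm \<Rightarrow> 'm"
  msmult :: "'r \<Rightarrow> 'm \<Rightarrow> 'm"

locale left_module =
  fixes V :: "('r::ring_1, 'm) left_module"
  assumes zero_closed: "mzero V \<in> mcarrier V"
    and add_closed: "x \<in> mcarrier V \<Longrightarrow> y \<in> mcarrier V \<Longrightarrow> madd V x y \<in> mcarrier V"
    and smult_closed: "x \<in> mcarrier V \<Longrightarrow> msmult V a x \<in> mcarrier V"
    and add_assoc: "x \<in> mcarrier V \<Longrightarrow> y \<in> mcarrier V \<Longrightarrow> u \<in> mcarrier V \<Longrightarrow>
      madd V (madd V x y) u = madd V x (madd V y u)"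
    and add_commute: "x \<in> mcarrier V \<Longrightarrow> y \<in> mcarrier V \<Longrightarrow> madd V x y = madd V y x"
    and add_zero: "x \<in> mcarrier V \<Longrightarrow> madd V (mzero V) x = x"
    and add_inverse: "x \<in> mcarrier V \<Longrightarrow> \<exists>y\<in>mcarrier V. madd V x y = mzero V"
    and smult_add_right: "x \<in> mcarrier V \<Longrightarrow> y \<in> mcarrier V \<Longrightarrow>
      msmult V a (madd V x y) = madd V (msmult V a x) (msmult V a y)"
    and smult_add_left: "x \<in> mcarrier V \<Longrightarrow>
      msmult V (a + b) x = madd V (msmult V a x) (msmult V b x)"
    and smult_assoc: "x \<in> mcarrier V \<Longrightarrow> msmult V (a * b) x = msmult V a (msmult V b x)"
    and smult_one: "x \<in> mcarrier V \<Longrightarrow> msmult V 1 x = x"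

text \<open>\<open>A \<otimes>\<^bsub>R\<^esub> B\<close>, where \<open>A\<close> is a right \<open>R\<close>-module via \<open>j: R \<rightarrow> A\<close> and \<open>act\<close> is the action of
  \<open>R\<close> on \<open>B\<close>: the free abelian group on \<open>A \<times> B\<close> modulo the usual relations.\<close>

definition tensor_relations ::
    "('r \<Rightarrow> 'a::ring_1) \<Rightarrow> ('r \<Rightarrow> 'b::ab_group_add \<Rightarrow> 'b) \<Rightarrow> ('a \<times> 'b \<Rightarrow>\<^sub>0 int) set"
  where "tensor_relations j act =
    {frag_of (a + a', b) - (frag_of (a, b) + frag_of (a', b)) | a a' b. True}
    \<union> {frag_of (a, b + b') - (frag_of (a, b) + frag_of (a, b')) | a b b'. True}
    \<union> {frag_of (a * j r, b) - frag_of (a, act r b) | a r b. True}"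

definition tensor_equiv ::
    "('r \<Rightarrow> 'a::ring_1) \<Rightarrow> ('r \<Rightarrow> 'b::ab_group_add \<Rightarrow> 'b) \<Rightarrow> ('a \<times> 'b \<Rightarrow>\<^sub>0 int) rel"
  where "tensor_equiv j act = {(x, y). x - y \<in> group_closure (tensor_relations j act)}"

definition tensor ::
    "('r \<Rightarrow> 'a::ring_1) \<Rightarrow> ('r \<Rightarrow> 'b::ab_group_add \<Rightarrow> 'b) \<Rightarrow> 'a \<Rightarrow> 'b \<Rightarrow> ('a \<times> 'b \<Rightarrow>\<^sub>0 int) set"
  where "tensor j act a b = tensor_equiv j act `` {frag_of (a, b)}"

definition tensor_lmult ::
    "'a::ring_1 \<Rightarrow> ('a \<times> 'b \<Rightarrow>\<^sub>0 int) \<Rightarrow> ('a \<times> 'b \<Rightarrow>\<^sub>0 int)"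
  where "tensor_lmult u = frag_extend (\<lambda>(a, b). frag_of (u * a, b))"

definition extension_module ::
    "('r \<Rightarrow> 'a::ring_1) \<Rightarrow> ('r \<Rightarrow> 'b::ab_group_add \<Rightarrow> 'b)
      \<Rightarrow> ('a, ('a \<times> 'b \<Rightarrow>\<^sub>0 int) set) left_module"
  where "extension_module j act =
    \<lparr>mcarrier = UNIV // tensor_equiv j act,
     mzero = tensor_equiv j act `` {0},
     madd = (\<lambda>X Y. tensor_equiv j act `` {x + y | x y. x \<in> X \<and> y \<in> Y}),
     msmult = (\<lambda>u X. tensor_equiv j act `` (tensor_lmult u ` X))\<rparr>"

lemma equiv_tensor_equiv: "equiv UNIV (tensor_equiv j act)"
proof (rule equivI)
  show "refl (tensor_equiv j act)"
    by (simp add: refl_on_def tensor_equiv_def)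
  show "sym (tensor_equiv j act)"
  proof (rule symI)
    fix x y assume "(x, y) \<in> tensor_equiv j act"
    then show "(y, x) \<in> tensor_equiv j act"
      using group_closure_minus_iff[of "x - y"] by (simp add: tensor_equiv_def)
  qed
  show "trans (tensor_equiv j act)"
  proof (rule transI)
    fix x y z assume "(x, y) \<in> tensor_equiv j act" "(y, z) \<in> tensor_equiv j act"
    then show "(x, z) \<in> tensor_equiv j act"
      using group_closure_add[of "x - y" _ "y - z"] by (simp add: tensor_equiv_def)
  qed
qed simp

lemma tensor_equiv_add:
  assumes "(x, x') \<in> tensor_equiv j act" "(y, y') \<in> tensor_equiv j act"
  shows "(x + y, x' + y') \<in> tensor_equiv j act"
  using group_closure_add[of "x - x'" _ "y - y'"] assms
  by (simp add: tensor_equiv_def add_diff_add)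

lemma tensor_lmult_add: "tensor_lmult u (x + y) = tensor_lmult u x + tensor_lmult u y"
  by (simp add: tensor_lmult_def frag_extend_add)

lemma tensor_lmult_diff: "tensor_lmult u (x - y) = tensor_lmult u x - tensor_lmult u y"
  by (simp add: tensor_lmult_def frag_extend_diff)

lemma tensor_lmult_frag_of: "tensor_lmult u (frag_of (a, b)) = frag_of (u * a, b)"
  by (simp add: tensor_lmult_def)

lemma tensor_lmult_closure:
  assumes "x \<in> group_closure (tensor_relations j act)"
  shows "tensor_lmult u x \<in> group_closure (tensor_relations j act)"
  using assms
proof (induction rule: group_closure.induct)
  case (base x)
  have "tensor_lmult u x \<in> insert 0 (tensor_relations j act)"
  proof (cases "x = 0")
    case True
    then show ?thesis by (simp add: tensor_lmult_def)
  next
    case False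
    with base have "x \<in> tensor_relations j act" by simp
    then consider (1) a a' b where "x = frag_of (a + a', b) - (frag_of (a, b) + frag_of (a', b))"
      | (2) a b b' where "x = frag_of (a, b + b') - (frag_of (a, b) + frag_of (a, b'))"
      | (3) a r b where "x = frag_of (a * j r, b) - frag_of (a, act r b)"
      unfolding tensor_relations_def by blast
    then have "tensor_lmult u x \<in> tensor_relations j act"
    proof cases
      case 1
      then show ?thesis unfolding tensor_relations_def
        by (simp add: tensor_lmult_add tensor_lmult_diff tensor_lmult_frag_of distrib_left) blast
    next
      case 2
      then show ?thesis unfolding tensor_relations_def
        by (simp add: tensor_lmult_add tensor_lmult_diff tensor_lmult_frag_of) blast
    next
      case 3
      then show ?thesis unfolding tensor_relations_def
        by (simp add: tensor_lmult_diff tensor_lmult_frag_of flip: mult.assoc) blast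
    qed
    then show ?thesis by simp
  qed
  then show ?case by (rule group_closure.base)
next
  case (diff x y)
  then show ?case by (simp add: tensor_lmult_diff group_closure.diff)
qed

lemma tensor_equiv_lmult:
  "(x, y) \<in> tensor_equiv j act \<Longrightarrow> (tensor_lmult u x, tensor_lmult u y) \<in> tensor_equiv j act"
  using tensor_lmult_closure[of "x - y"] by (simp add: tensor_equiv_def tensor_lmult_diff)

lemma extension_carrier: "mcarrier (extension_module j act) = {tensor_equiv j act `` {x} | x. True}"
  by (auto simp: extension_module_def quotient_def)

lemma tensor_equiv_Image_eqI:
  assumes "x \<in> X" and "\<And>y. y \<in> X \<Longrightarrow> (x, y) \<in> tensor_equiv j act"
  shows "tensor_equiv j act `` X = tensor_equiv j act `` {x}"
proof -
  have "tensor_equiv j act `` {y} = tensor_equiv j act `` {x}" if "y \<in> X" for y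
    using equiv_class_eq[OF equiv_tensor_equiv assms(2)[OF that]] by simp
  then show ?thesis using assms(1) by blast
qed

lemma tensor_equiv_refl: "(x, x) \<in> tensor_equiv j act"
  by (simp add: tensor_equiv_def)

lemma extension_add:
  "madd (extension_module j act) (tensor_equiv j act `` {x}) (tensor_equiv j act `` {y})
    = tensor_equiv j act `` {x + y}"
  unfolding extension_module_def left_module.simps
proof (rule tensor_equiv_Image_eqI)
  show "x + y \<in> {a + b |a b. a \<in> tensor_equiv j act `` {x} \<and> b \<in> tensor_equiv j act `` {y}}"
    using tensor_equiv_refl by blast
qed (blast intro: tensor_equiv_add)

lemma extension_smult:
  "msmult (extension_module j act) u (tensor_equiv j act `` {x})
    = tensor_equiv j act `` {tensor_lmult u x}"
  unfolding extension_module_def left_module.simps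
proof (rule tensor_equiv_Image_eqI)
  show "tensor_lmult u x \<in> tensor_lmult u ` (tensor_equiv j act `` {x})"
    using tensor_equiv_refl by blast
qed (blast intro: tensor_equiv_lmult)

lemma extension_zero: "mzero (extension_module j act) = tensor_equiv j act `` {0}"
  by (simp add: extension_module_def)

lemma extension_eq_iff:
  "tensor_equiv j act `` {x} = tensor_equiv j act `` {y}
    \<longleftrightarrow> x - y \<in> group_closure (tensor_relations j act)"
  using eq_equiv_class_iff[OF equiv_tensor_equiv, of x y j act] by (simp add: tensor_equiv_def)

lemma tensor_add_left: "tensor j act (a + a') b
    = madd (extension_module j act) (tensor j act a b) (tensor j act a' b)"
  unfolding tensor_def extension_add extension_eq_iff tensor_relations_def
  by (intro group_closure.base) blast

lemma tensor_balanced: "tensor j act (a * j r) b = tensor j act a (act r b)"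
  unfolding tensor_def extension_eq_iff tensor_relations_def
  by (intro group_closure.base) blast

lemma tensor_smult: "msmult (extension_module j act) u (tensor j act a b) = tensor j act (u * a) b"
  by (simp add: tensor_def extension_smult tensor_lmult_frag_of)

lemma tensor_lmult_one: "tensor_lmult 1 x = x"
  by (simp add: tensor_lmult_def case_prod_beta' flip: frag_expansion)

lemma tensor_lmult_mult: "tensor_lmult (u * v) x = tensor_lmult u (tensor_lmult v x)"
  by (induction x rule: frag_induction[OF subset_UNIV])
    (auto simp: tensor_lmult_diff tensor_lmult_frag_of mult.assoc, simp add: tensor_lmult_def)

lemma tensor_lmult_add_left:
  "tensor_lmult (u + v) x - (tensor_lmult u x + tensor_lmult v x)
    \<in> group_closure (tensor_relations j act)"
proof (induction x rule: frag_induction[OF subset_UNIV])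
  case 1
  show ?case by (simp add: tensor_lmult_def)
next
  case (2 x)
  obtain a b where x: "x = (a, b)" by fastforce
  show ?case unfolding x tensor_lmult_frag_of distrib_right
    by (rule group_closure.base) (unfold tensor_relations_def, blast)
next
  case (3 x y)
  from group_closure.diff[OF this] show ?case
    by (simp add: tensor_lmult_diff algebra_simps)
qed

lemma left_module_extension: "left_module (extension_module j act)"
proof -
  have cases: thesis if "X \<in> mcarrier (extension_module j act)"
    "\<And>x. X = tensor_equiv j act `` {x} \<Longrightarrow> thesis" for X thesis
    using that unfolding extension_carrier by blast
  have closed: "tensor_equiv j act `` {x} \<in> mcarrier (extension_module j act)" for x
    unfolding extension_carrier by blast
  show ?thesis
  proof (standard, goal_cases)
    case 1
    show ?case unfolding extension_zero by (rule closed)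
  next
    case (2 X Y)
    then show ?case by (elim cases) (simp only: extension_add closed)
  next
    case (3 X u)
    then show ?case by (elim cases) (simp only: extension_smult closed)
  next
    case (4 X Y Z)
    then show ?case by (elim cases) (simp only: extension_add add.assoc)
  next
    case (5 X Y)
    then show ?case by (elim cases) (simp only: extension_add add.commute)
  next
    case (6 X)
    then show ?case by (elim cases) (simp only: extension_add extension_zero add_0_left)
  next
    case (7 X)
    then obtain x where X: "X = tensor_equiv j act `` {x}" by (rule cases)
    show ?case
      by (rule bexI[OF _ closed[of "- x"]]) (simp add: X extension_add extension_zero)
  next
    case (8 X Y u)
    then show ?case
      by (elim cases) (simp only: extension_add extension_smult tensor_lmult_add)
  next
    case (9 X u v)
    then show ?case
      by (elim cases)
        (simp only: extension_add extension_smult extension_eq_iff tensor_lmult_add_left)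
  next
    case (10 X u v)
    then show ?case by (elim cases) (simp only: extension_smult tensor_lmult_mult)
  next
    case (11 X)
    then show ?case by (elim cases) (simp only: extension_smult tensor_lmult_one)
  qed
qed


section \<open>Universal quasi-Whittaker modules\<close>

text \<open>An \<open>\<SS>\<close>-module is a left \<open>U(\<SS>)\<close>-module; \<open>\<complex>\<close> and \<open>\<SS>\<close> act through
  \<^const>\<open>uea_scalar\<close> and \<^const>\<open>uea_gen\<close>.\<close>

definition quasi_whittaker_vector ::
    "(heisenberg \<Rightarrow> complex) \<Rightarrow> (schroedinger uea, 'm) left_module \<Rightarrow> 'm \<Rightarrow> bool"
  where "quasi_whittaker_vector \<phi> V v \<longleftrightarrow>
    v \<in> mcarrier V \<and> v \<noteq> mzero V \<and>
    (\<forall>x. msmult V (uea_gen (heis_incl x)) v = msmult V (uea_scalar (\<phi> x)) v)"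

text \<open>The action of \<open>U(\<H>)\<close> on \<open>\<complex>\<^bsub>\<phi>\<^esub>\<close>.\<close>

definition character_act :: "('g::complex_lie_algebra \<Rightarrow> complex) \<Rightarrow> 'g uea \<Rightarrow> complex \<Rightarrow> complex"
  where "character_act \<phi> u c = uea_lift id \<phi> u * c"

definition quasi_whittaker_module :: "(heisenberg \<Rightarrow> complex) \<Rightarrow>
    (schroedinger uea, (schroedinger uea \<times> complex \<Rightarrow>\<^sub>0 int) set) left_module"
  where "quasi_whittaker_module \<phi> = extension_module (uea_map heis_incl) (character_act \<phi>)"

definition cyclic_vector ::
    "(heisenberg \<Rightarrow> complex) \<Rightarrow> (schroedinger uea \<times> complex \<Rightarrow>\<^sub>0 int) set"
  where "cyclic_vector \<phi> = tensor (uea_map heis_incl) (character_act \<phi>) 1 1"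

definition C_elem :: "(heisenberg \<Rightarrow> complex) \<Rightarrow> schroedinger uea"
  where "C_elem \<phi> =
    uea_scalar ((\<phi> heis_p)\<^sup>2) * uea_gen sch_f
    - uea_scalar ((\<phi> heis_q)\<^sup>2) * uea_gen sch_e
    - uea_scalar (\<phi> heis_p * \<phi> heis_q) * uea_gen sch_h"

lemma cyclic_vector_carrier: "cyclic_vector \<phi> \<in> mcarrier (quasi_whittaker_module \<phi>)"
  unfolding cyclic_vector_def quasi_whittaker_module_def extension_carrier tensor_def by blast

lemma cyclic_vector_quasi_whittaker:
  assumes "lie_hom \<phi>"
  shows "msmult (quasi_whittaker_module \<phi>) (uea_gen (heis_incl x)) (cyclic_vector \<phi>)
    = msmult (quasi_whittaker_module \<phi>) (uea_scalar (\<phi> x)) (cyclic_vector \<phi>)"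
proof -
  interpret i: uea_data uea_scalar "\<lambda>x. uea_gen (heis_incl x)"
    by (rule uea_data_map) (rule lie_hom_heis_incl)
  interpret c: uea_data id \<phi>
    by (rule uea_data_character) fact
  have gen: "uea_gen (heis_incl x) * 1 = 1 * uea_map heis_incl (uea_gen x)"
    by (simp add: uea_map_def i.uea_lift_gen)
  have scalar: "uea_scalar (\<phi> x) * 1 = 1 * uea_map heis_incl (uea_scalar (\<phi> x))"
    by (simp add: uea_map_def i.uea_lift_scalar)
  show ?thesis
    unfolding quasi_whittaker_module_def cyclic_vector_def tensor_smult gen scalar tensor_balanced
    by (simp add: character_act_def c.uea_lift_gen c.uea_lift_scalar)
qed

end

theory Submission
  imports Defs
begin

text \<open>
  Put \<open>a = \<phi>(p)\<close>, \<open>b = \<phi>(q)\<close>, \<open>P = p - a\<close> and \<open>Q = q - b\<close>. Every vector of \<open>M\<^sub>\<phi>\<close> is of the form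
  \<open>u w\<close>, so a quasi-Whittaker vector corresponds to some \<open>u \<in> U(\<SS>)\<close> with \<open>P u\<close> and \<open>Q u\<close> in the
  annihilator \<open>J\<close> of \<open>w\<close>, and the claim becomes \<open>u \<in> \<complex>[C] + J\<close>.

  Modulo the left ideal generated by \<open>P\<close> and \<open>Q\<close>, the commutators of \<open>P\<close> and of \<open>Q\<close> with an
  element \<open>x\<close> of \<open>\<ss>\<ll>\<^sub>2 = span {e, h, f}\<close> are scalars, given by two linear forms in \<open>x\<close>. As
  \<open>\<phi> \<noteq> 0\<close>, the forms are linearly independent; their common kernel is spanned by \<open>C\<close>, and there
  are \<open>X, Y\<close> dual to them: up to terms in which \<open>P\<close> or \<open>Q\<close> survives on the right,
  \<open>[P,X] = [Q,Y] = 1\<close> and \<open>[P,Y] = [Q,X] = 0\<close>. So \<open>P\<close> and \<open>Q\<close> behave like the partial derivatives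
  in two variables \<open>X\<close> and \<open>Y\<close>, with \<open>\<complex>[C]\<close> as constants, and \<open>X P + Y Q\<close> behaves like the
  Euler operator, which multiplies a form of degree \<open>d\<close> by \<open>d\<close>.

  Precisely, filter \<open>U(\<SS>)\<close> by the number of factors \<open>X\<close>, \<open>Y\<close> standing to the left of a
  polynomial in \<open>C\<close>. The operators \<open>P\<close> and \<open>Q\<close> lower the filtration degree by one (\<open>F_PQ\<close>), and
  on degree \<open>d\<close> the operator \<open>X P + Y Q\<close> agrees with \<open>d\<close> up to lower degree (\<open>F_euler\<close>). If
  \<open>P u, Q u \<in> J\<close> and \<open>u\<close> has degree at most \<open>d > 0\<close>, then \<open>d u\<close>, and hence \<open>u\<close>, has degree at
  most \<open>d - 1\<close>. Descending to degree \<open>0\<close> gives \<open>u \<in> \<complex>[C] + J\<close> (\<open>PQ_kernel\<close>).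
\<close>

section \<open>The scalars and the generators of an enveloping algebra\<close>

lemma abs_uea_add: "abs_uea (x + y) = abs_uea x + abs_uea y"
  by (simp add: plus_uea.abs_eq)

lemma uea_induct [case_names scalar add gen]:
  fixes u :: "'g::complex_lie_algebra uea"
  assumes scalar: "\<And>c. P (uea_scalar c)"
    and add: "\<And>u v. P u \<Longrightarrow> P v \<Longrightarrow> P (u + v)"
    and gen: "\<And>x u. P u \<Longrightarrow> P (uea_gen x * u)"
  shows "P u"
proof (induction u rule: uea.abs_induct)
  case (1 y)
  show ?case
  proof (induction y rule: free_algebra_induct)
    case (single w c)
    have "P (abs_uea (Poly_Mapping.single (Word xs) c))" for xs
    proof (induction xs)
      case Nil
      show ?case
        using scalar[of c] by (simp add: uea_scalar.abs_eq fa_const_def zero_word_def)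
    next
      case (Cons x xs)
      have "Poly_Mapping.single (Word (x # xs)) c = fa_gen x * Poly_Mapping.single (Word xs) c"
        by (simp add: fa_gen_def mult_single plus_word_def)
      then show ?case
        using gen[OF Cons, of x] by (simp add: uea_gen.abs_eq times_uea.abs_eq)
    qed
    from this[of "letters w"] show ?case by simp
  next
    case (add y z)
    then show ?case using assms(2) by (simp add: abs_uea_add)
  qed
qed

lemma uea_scalar_commute: "uea_scalar c * u = u * uea_scalar c"
proof (induction u rule: uea_induct)
  case (scalar d)
  show ?case by (simp add: mult.commute flip: uea_scalar_mult)
next
  case (gen x u)
  have "uea_scalar c * (uea_gen x * u) = uea_gen x * (uea_scalar c * u)"
    by (simp add: uea_scalar_gen flip: mult.assoc)
  then show ?case by (simp add: gen mult.assoc)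
qed (simp add: algebra_simps)

lemma uea_scalar_left_commute: "u * (uea_scalar c * v) = uea_scalar c * (u * v)"
  by (metis mult.assoc uea_scalar_commute)

lemma uea_scalar_zero [simp]: "uea_scalar 0 = 0"
  using uea_scalar_add[of 0 0] by simp

lemma uea_scalar_minus: "uea_scalar (- c) = - uea_scalar c"
  using uea_scalar_add[of c "- c"] by (simp add: eq_neg_iff_add_eq_0 add.commute)

lemma uea_scalar_diff: "uea_scalar (c - d) = uea_scalar c - uea_scalar d"
  by (simp add: eq_diff_eq flip: uea_scalar_add)

lemma uea_gen_commute: "uea_gen x * uea_gen y = uea_gen y * uea_gen x + uea_gen (lie_bracket x y)"
  by (simp add: uea_gen_bracket)

lemma uea_poly_eq_sum:
  assumes "degree c \<le> n"
  shows "uea_poly c u = (\<Sum>i\<le>n. uea_scalar (coeff c i) * u ^ i)"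
  unfolding uea_poly_def using assms
  by (intro sum.mono_neutral_left) (auto simp: coeff_eq_0)

lemma uea_poly_add: "uea_poly (c + d) u = uea_poly c u + uea_poly d u"
proof -
  let ?n = "max (degree c) (degree d)"
  have "degree (c + d) \<le> ?n" by (rule degree_add_le_max)
  then show ?thesis
    by (simp add: uea_poly_eq_sum[of _ ?n] uea_scalar_add distrib_right sum.distrib)
qed

lemma uea_poly_smult: "uea_poly (smult c d) u = uea_scalar c * uea_poly d u"
  by (simp add: uea_poly_eq_sum[of _ "degree d"] uea_scalar_mult mult.assoc sum_distrib_left)

lemma uea_poly_pCons: "uea_poly (pCons c d) u = uea_scalar c + u * uea_poly d u"
proof -
  have "uea_poly (pCons c d) u = (\<Sum>i\<le>Suc (degree d). uea_scalar (coeff (pCons c d) i) * u ^ i)"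
    by (rule uea_poly_eq_sum) (rule degree_pCons_le)
  also have "\<dots> = uea_scalar c + u * uea_poly d u"
    by (simp add: sum.atMost_Suc_shift uea_poly_def sum_distrib_left uea_scalar_left_commute
        del: sum.atMost_Suc)
  finally show ?thesis .
qed

lemma uea_poly_zero: "uea_poly 0 u = 0"
  by (simp add: uea_poly_def)


section \<open>Two linear forms on the special linear subalgebra\<close>

definition sl2 :: "schroedinger set"
  where "sl2 = {x. cp x = 0 \<and> cq x = 0 \<and> cz x = 0}"

text \<open>The scalars to which \<open>[p - a, x]\<close> and \<open>[q - b, x]\<close> reduce when \<open>p\<close> is replaced by \<open>a\<close>
  and \<open>q\<close> by \<open>b\<close>; see \<open>p_commute\<close> and \<open>q_commute\<close> below.\<close>

definition p_form :: "complex \<Rightarrow> complex \<Rightarrow> schroedinger \<Rightarrow> complex"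
  where "p_form a b x = - a * ch x - b * cf x"

definition q_form :: "complex \<Rightarrow> complex \<Rightarrow> schroedinger \<Rightarrow> complex"
  where "q_form a b x = - a * ce x + b * ch x"

definition C_vec :: "complex \<Rightarrow> complex \<Rightarrow> schroedinger"
  where "C_vec a b = Schroedinger (- b\<^sup>2) (- (a * b)) (a\<^sup>2) 0 0 0"

lemma sl2_bracket: "x \<in> sl2 \<Longrightarrow> y \<in> sl2 \<Longrightarrow> lie_bracket x y \<in> sl2"
  by (simp add: sl2_def lie_bracket_schroedinger_def)

lemma C_vec_sl2: "C_vec a b \<in> sl2"
  by (simp add: C_vec_def sl2_def)

text \<open>The forms are linearly independent unless \<open>a = b = 0\<close>, so they can be extended to a basis
  of the dual space of \<open>\<ss>\<ll>\<^sub>2\<close>.\<close>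

lemma dual_vectors_exist:
  assumes "a \<noteq> 0 \<or> b \<noteq> 0"
  obtains x y where "x \<in> sl2" "y \<in> sl2" "p_form a b x = 1" "q_form a b x = 0"
    "p_form a b y = 0" "q_form a b y = 1"
proof (cases "a = 0")
  case False
  then show ?thesis
    by (intro that[of "Schroedinger (- b / a\<^sup>2) (- 1 / a) 0 0 0 0" "Schroedinger (- 1 / a) 0 0 0 0 0"])
      (simp_all add: sl2_def p_form_def q_form_def power2_eq_square)
next
  case True
  with assms show ?thesis
    by (intro that[of "Schroedinger 0 0 (- 1 / b) 0 0 0" "Schroedinger 0 (1 / b) 0 0 0 0"])
      (simp_all add: sl2_def p_form_def q_form_def)
qed

lemma forms_kernel:
  assumes "a \<noteq> 0 \<or> b \<noteq> 0" and "x \<in> sl2" and "p_form a b x = 0" and "q_form a b x = 0"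
  obtains c where "x = c *\<^sub>L C_vec a b"
proof (cases "a = 0")
  case False
  have "a * ch x = - b * cf x" "a * ce x = b * ch x"
    using assms(3,4) unfolding p_form_def q_form_def by algebra+
  then have "ch x = - b * cf x / a" "ce x = b * ch x / a"
    using False by (metis nonzero_mult_div_cancel_left)+
  then have "ch x = - b * cf x / a" "ce x = - (b * b * cf x) / (a * a)" by simp_all
  with False assms(2) show ?thesis
    by (intro that[of "cf x / a\<^sup>2"])
      (cases x; simp add: sl2_def C_vec_def lie_scale_schroedinger_def field_simps power2_eq_square)
next
  case True
  with assms show ?thesis
    by (intro that[of "- ce x / b\<^sup>2"])
      (cases x; simp add: sl2_def p_form_def q_form_def C_vec_def lie_scale_schroedinger_def)
qed


section \<open>The filtration of a cyclic module\<close>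

text \<open>Any left ideal containing \<open>p - a\<close> and \<open>q - b\<close> is the annihilator of a vector that
  generates a module and on which \<open>p\<close> and \<open>q\<close> act as \<open>a\<close> and \<open>b\<close>. The result thus covers every quotient
  of \<open>M\<^sub>\<phi>\<close>. The vectors \<open>x\<^sub>p\<close>, \<open>x\<^sub>q\<close> are a choice of duals to the two forms.\<close>

locale quasi_whittaker_annihilator =
  fixes a b :: complex and J :: "schroedinger uea set" and x\<^sub>p x\<^sub>q :: schroedinger
  assumes nontrivial: "a \<noteq> 0 \<or> b \<noteq> 0"
    and J_add: "u \<in> J \<Longrightarrow> v \<in> J \<Longrightarrow> u + v \<in> J"
    and J_mult: "u \<in> J \<Longrightarrow> v * u \<in> J"
    and J_p: "uea_gen sch_p - uea_scalar a \<in> J"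
    and J_q: "uea_gen sch_q - uea_scalar b \<in> J"
    and dual_sl2: "x\<^sub>p \<in> sl2" "x\<^sub>q \<in> sl2"
    and dual_p: "p_form a b x\<^sub>p = 1" "q_form a b x\<^sub>p = 0"
    and dual_q: "p_form a b x\<^sub>q = 0" "q_form a b x\<^sub>q = 1"
begin

definition P :: "schroedinger uea"
  where "P = uea_gen sch_p - uea_scalar a"

definition Q :: "schroedinger uea"
  where "Q = uea_gen sch_q - uea_scalar b"

definition X :: "schroedinger uea"
  where "X = uea_gen x\<^sub>p"

definition Y :: "schroedinger uea"
  where "Y = uea_gen x\<^sub>q"

definition C :: "schroedinger uea"
  where "C = uea_gen (C_vec a b)"

lemma sl2_decomposition:
  assumes "x \<in> sl2"
  obtains c where "uea_gen x
    = uea_scalar (p_form a b x) * X + uea_scalar (q_form a b x) * Y + uea_scalar c * C"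
proof -
  let ?y = "p_form a b x *\<^sub>L x\<^sub>p + q_form a b x *\<^sub>L x\<^sub>q"
  have lin: "p_form a b (x - ?y) = p_form a b x - p_form a b x * p_form a b x\<^sub>p
      - q_form a b x * p_form a b x\<^sub>q"
    "q_form a b (x - ?y) = q_form a b x - p_form a b x * q_form a b x\<^sub>p
      - q_form a b x * q_form a b x\<^sub>q"
    by (simp_all add: p_form_def q_form_def schroedinger_defs algebra_simps)
  have "x - ?y \<in> sl2"
    using assms dual_sl2 by (simp add: sl2_def schroedinger_defs)
  moreover have "p_form a b (x - ?y) = 0" "q_form a b (x - ?y) = 0"
    by (simp_all add: lin dual_p dual_q)
  ultimately obtain c where "x - ?y = c *\<^sub>L C_vec a b"
    using forms_kernel[OF nontrivial] by metis
  then have "x = ?y + c *\<^sub>L C_vec a b"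
    by (simp add: algebra_simps)
  then have "uea_gen x = uea_gen (?y + c *\<^sub>L C_vec a b)" by (rule arg_cong)
  then show ?thesis
    by (intro that[of c]) (simp add: uea_gen_add uea_gen_scale X_def Y_def C_def)
qed

text \<open>In the commutator \<open>[p, x]\<close>, a combination of \<open>p\<close> and \<open>q\<close>, substitute \<open>p = P + a\<close> and
  \<open>q = Q + b\<close>: besides the scalar there remain terms in which \<open>P\<close> or \<open>Q\<close> acts first.\<close>

lemma p_commute:
  assumes "x \<in> sl2"
  shows "P * (uea_gen x * u) = uea_gen x * (P * u) - uea_scalar (ch x) * (P * u)
    - uea_scalar (cf x) * (Q * u) + uea_scalar (p_form a b x) * u"
proof -
  have br: "lie_bracket sch_p x = (- ch x) *\<^sub>L sch_p + (- cf x) *\<^sub>L sch_q"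
    using assms by (simp add: sl2_def schroedinger_defs)
  have gen: "uea_gen sch_p * uea_gen x = uea_gen x * uea_gen sch_p
      - uea_scalar (ch x) * uea_gen sch_p - uea_scalar (cf x) * uea_gen sch_q"
    by (subst uea_gen_commute)
      (simp only: br uea_gen_add uea_gen_scale uea_scalar_minus, simp)
  have form: "uea_scalar (p_form a b x)
      = - (uea_scalar (ch x) * uea_scalar a) - uea_scalar (cf x) * uea_scalar b"
    by (simp add: p_form_def mult.commute flip: uea_scalar_mult uea_scalar_minus
        uea_scalar_diff uea_scalar_add)
  have "P * uea_gen x = uea_gen x * P - uea_scalar (ch x) * P
      - uea_scalar (cf x) * Q + uea_scalar (p_form a b x)"
    unfolding form P_def Q_def by (simp add: gen algebra_simps uea_scalar_gen)
  then have "P * uea_gen x * u = (uea_gen x * P - uea_scalar (ch x) * P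
      - uea_scalar (cf x) * Q + uea_scalar (p_form a b x)) * u" by simp
  then show ?thesis by (simp add: algebra_simps)
qed

lemma q_commute:
  assumes "x \<in> sl2"
  shows "Q * (uea_gen x * u) = uea_gen x * (Q * u) - uea_scalar (ce x) * (P * u)
    + uea_scalar (ch x) * (Q * u) + uea_scalar (q_form a b x) * u"
proof -
  have br: "lie_bracket sch_q x = (- ce x) *\<^sub>L sch_p + ch x *\<^sub>L sch_q"
    using assms by (simp add: sl2_def schroedinger_defs)
  have gen: "uea_gen sch_q * uea_gen x = uea_gen x * uea_gen sch_q
      - uea_scalar (ce x) * uea_gen sch_p + uea_scalar (ch x) * uea_gen sch_q"
    by (subst uea_gen_commute)
      (simp only: br uea_gen_add uea_gen_scale uea_scalar_minus, simp)
  have form: "uea_scalar (q_form a b x)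
      = - (uea_scalar (ce x) * uea_scalar a) + uea_scalar (ch x) * uea_scalar b"
    by (simp add: q_form_def mult.commute flip: uea_scalar_mult uea_scalar_minus
        uea_scalar_diff uea_scalar_add)
  have "Q * uea_gen x = uea_gen x * Q - uea_scalar (ce x) * P
      + uea_scalar (ch x) * Q + uea_scalar (q_form a b x)"
    unfolding form P_def Q_def by (simp add: gen algebra_simps uea_scalar_gen)
  then have "Q * uea_gen x * u = (uea_gen x * Q - uea_scalar (ce x) * P
      + uea_scalar (ch x) * Q + uea_scalar (q_form a b x)) * u" by simp
  then show ?thesis by (simp add: algebra_simps)
qed

lemma J_zero: "0 \<in> J"
  using J_mult[OF J_p, of 0] by simp

lemma J_minus: "u \<in> J \<Longrightarrow> - u \<in> J"
  using J_mult[of u "- 1"] by simp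

lemma J_diff: "u \<in> J \<Longrightarrow> v \<in> J \<Longrightarrow> u - v \<in> J"
  using J_add[OF _ J_minus] by fastforce

text \<open>Both forms vanish at \<open>C\<close>, so moving \<open>P\<close> or \<open>Q\<close> past a factor \<open>C\<close> only leaves terms in
  which \<open>P\<close> or \<open>Q\<close> acts on a smaller power of \<open>C\<close>.\<close>

lemma PQ_poly_C: "P * uea_poly c C \<in> J \<and> Q * uea_poly c C \<in> J"
proof (induction c)
  case 0
  show ?case by (simp add: uea_poly_zero J_zero)
next
  case (pCons c d)
  have forms: "p_form a b (C_vec a b) = 0" "q_form a b (C_vec a b) = 0"
    by (simp_all add: p_form_def q_form_def C_vec_def power2_eq_square)
  have "P * (C * uea_poly d C) \<in> J" "Q * (C * uea_poly d C) \<in> J"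
    unfolding C_def p_commute[OF C_vec_sl2] q_commute[OF C_vec_sl2] forms
    using pCons.IH by (auto simp: C_def intro!: J_add J_diff J_mult J_zero)
  moreover have "P * uea_scalar c \<in> J" "Q * uea_scalar c \<in> J"
    using J_mult[OF J_p, of "uea_scalar c"] J_mult[OF J_q, of "uea_scalar c"]
    by (simp_all add: P_def Q_def uea_scalar_commute)
  ultimately show ?case
    by (simp add: uea_poly_pCons distrib_left J_add)
qed

text \<open>The filtration by degree in \<open>X\<close> and \<open>Y\<close> over the constants \<open>\<complex>[C]\<close>, all modulo \<open>J\<close>. The
  index is the degree plus one, so that \<open>F 0\<close> is \<open>J\<close> and \<open>F 1\<close> is \<open>\<complex>[C] + J\<close>; then lowering
  the degree of a constant needs no separate treatment.\<close>

inductive F :: "nat \<Rightarrow> schroedinger uea \<Rightarrow> bool" where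
  J: "u \<in> J \<Longrightarrow> F n u"
| poly: "F (Suc n) (uea_poly c C)"
| add: "F n u \<Longrightarrow> F n v \<Longrightarrow> F n (u + v)"
| X: "F n u \<Longrightarrow> F (Suc n) (X * u)"
| Y: "F n u \<Longrightarrow> F (Suc n) (Y * u)"

lemma F_zero: "F 0 u \<Longrightarrow> u \<in> J"
  by (induction "0::nat" u rule: F.induct) (auto intro: J_add)

lemma F_one: "F (Suc 0) u \<Longrightarrow> \<exists>c. \<exists>j\<in>J. u = uea_poly c C + j"
proof (induction "Suc 0" u rule: F.induct)
  case (J u)
  then show ?case by (intro exI[of _ 0]) (simp add: uea_poly_zero)
next
  case (poly c)
  show ?case using J_zero by (intro exI[of _ c]) force
next
  case (add u v)
  then obtain c d i j where "i \<in> J" "j \<in> J" "u = uea_poly c C + i" "v = uea_poly d C + j"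
    by blast
  then show ?case
    by (intro exI[of _ "c + d"] bexI[of _ "i + j"]) (simp_all add: uea_poly_add J_add)
next
  case (X u)
  then show ?case
    by (intro exI[of _ 0] bexI[of _ "X * u"]) (simp_all add: uea_poly_zero F_zero J_mult)
next
  case (Y u)
  then show ?case
    by (intro exI[of _ 0] bexI[of _ "Y * u"]) (simp_all add: uea_poly_zero F_zero J_mult)
qed

lemma F_Suc: "F n u \<Longrightarrow> F (Suc n) u"
  by (induction rule: F.induct) (auto intro: F.intros)

lemma F_mono: "n \<le> m \<Longrightarrow> F n u \<Longrightarrow> F m u"
  by (induction rule: dec_induct) (auto intro: F_Suc)

lemma F_scalar: "F n u \<Longrightarrow> F n (uea_scalar c * u)"
proof (induction rule: F.induct)
  case (poly n d)
  show ?case using F.poly[of n "smult c d"] by (simp add: uea_poly_smult)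
next
  case (add n u v)
  then show ?case by (simp add: distrib_left F.add)
qed (auto simp: intro: F.intros J_mult simp flip: uea_scalar_left_commute)

lemma F_minus: "F n u \<Longrightarrow> F n (- u)"
  using F_scalar[of n u "- 1"] by (simp add: uea_scalar_minus uea_scalar_one)

lemma F_diff: "F n u \<Longrightarrow> F n v \<Longrightarrow> F n (u - v)"
  using F.add[OF _ F_minus] by fastforce

lemmas F_closure = F.add F_diff F_scalar

text \<open>Stability of the filtration under \<open>C\<close> is a hypothesis at \<open>u\<close> here, because its inductive
  proof in \<open>F_C\<close> applies this lemma to the commutators \<open>[C, X]\<close> and \<open>[C, Y]\<close>.\<close>

lemma F_sl2_aux:
  assumes "x \<in> sl2" "F n u" "F n (C * u)"
  shows "F (Suc n) (uea_gen x * u)"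
proof -
  from sl2_decomposition[OF assms(1)] obtain c where
    "uea_gen x = uea_scalar (p_form a b x) * X + uea_scalar (q_form a b x) * Y + uea_scalar c * C" .
  then show ?thesis
    using assms(2,3)
    by (auto simp: distrib_right mult.assoc intro!: F_closure F.X F.Y intro: F_Suc)
qed

text \<open>Polynomials in \<open>C\<close> stand to the right of \<open>X\<close> and \<open>Y\<close>. A further factor \<open>C\<close> on the left
  can be moved there because each commutator \<open>[C, X]\<close>, \<open>[C, Y]\<close> lies again in \<open>\<ss>\<ll>\<^sub>2\<close>, and
  so raises the index no more than the factor it replaces.\<close>

lemma F_C: "F n u \<Longrightarrow> F n (C * u)"
proof (induction rule: F.induct)
  case (J u n)
  then show ?case by (simp add: F.J J_mult)
next
  case (poly n c)
  show ?case using F.poly[of n "pCons 0 c"] by (simp add: uea_poly_pCons)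
next
  case (add n u v)
  then show ?case by (simp add: distrib_left F.add)
next
  case (X n u)
  have "C * (X * u) = X * (C * u) + uea_gen (lie_bracket (C_vec a b) x\<^sub>p) * u"
    by (simp add: C_def X_def uea_gen_bracket algebra_simps)
  with X show ?case
    by (auto intro!: F.add F.X F_sl2_aux sl2_bracket C_vec_sl2 dual_sl2)
next
  case (Y n u)
  have "C * (Y * u) = Y * (C * u) + uea_gen (lie_bracket (C_vec a b) x\<^sub>q) * u"
    by (simp add: C_def Y_def uea_gen_bracket algebra_simps)
  with Y show ?case
    by (auto intro!: F.add F.Y F_sl2_aux sl2_bracket C_vec_sl2 dual_sl2)
qed

lemma F_sl2: "x \<in> sl2 \<Longrightarrow> F n u \<Longrightarrow> F (Suc n) (uea_gen x * u)"
  by (intro F_sl2_aux F_C)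

text \<open>Like partial derivatives, \<open>P\<close> and \<open>Q\<close> kill the constants \<open>\<complex>[C]\<close> and remove one of the
  variables \<open>X\<close>, \<open>Y\<close>.\<close>

lemma F_PQ: "F n u \<Longrightarrow> F (n - 1) (P * u) \<and> F (n - 1) (Q * u)"
proof (induction rule: F.induct)
  case (J u n)
  then show ?case by (simp add: F.J J_mult)
next
  case (poly n c)
  show ?case using PQ_poly_C by (simp add: F.J)
next
  case (add n u v)
  then show ?case by (simp add: distrib_left F.add)
next
  case (X n u)
  show ?case
  proof (cases n)
    case 0
    then show ?thesis using X F_zero by (simp add: F.J J_mult)
  next
    case (Suc m)
    with X.IH have "F n (P * u)" "F n (Q * u)" "F n (X * (P * u))" "F n (X * (Q * u))"
      by (auto intro: F_Suc F.X)
    with X.hyps show ?thesis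
      unfolding X_def p_commute[OF dual_sl2(1)] q_commute[OF dual_sl2(1)]
      by (auto intro!: F_closure)
  qed
next
  case (Y n u)
  show ?case
  proof (cases n)
    case 0
    then show ?thesis using Y F_zero by (simp add: F.J J_mult)
  next
    case (Suc m)
    with Y.IH have "F n (P * u)" "F n (Q * u)" "F n (Y * (P * u))" "F n (Y * (Q * u))"
      by (auto intro: F_Suc F.Y)
    with Y.hyps show ?thesis
      unfolding Y_def p_commute[OF dual_sl2(2)] q_commute[OF dual_sl2(2)]
      by (auto intro!: F_closure)
  qed
qed

definition euler :: "schroedinger uea \<Rightarrow> schroedinger uea"
  where "euler u = X * (P * u) + Y * (Q * u)"

lemma euler_add: "euler (u + v) = euler u + euler v"
  by (simp add: euler_def algebra_simps)

lemma euler_J: "u \<in> J \<Longrightarrow> euler u \<in> J"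
  by (simp add: euler_def J_add J_mult)

lemma euler_poly: "euler (uea_poly c C) \<in> J"
  using PQ_poly_C by (simp add: euler_def J_add J_mult)

lemma euler_commute_X:
  "euler (X * u) = X * euler u + X * u + uea_gen (lie_bracket x\<^sub>q x\<^sub>p) * (Q * u)
    - uea_scalar (ch x\<^sub>p) * (X * (P * u)) - uea_scalar (cf x\<^sub>p) * (X * (Q * u))
    - uea_scalar (ce x\<^sub>p) * (Y * (P * u)) + uea_scalar (ch x\<^sub>p) * (Y * (Q * u))"
  unfolding euler_def p_commute[OF dual_sl2(1), folded X_def] q_commute[OF dual_sl2(1), folded X_def]
  by (simp add: dual_p uea_scalar_one uea_gen_bracket uea_scalar_left_commute algebra_simps
      flip: X_def Y_def)

lemma euler_commute_Y:
  "euler (Y * u) = Y * euler u + Y * u + uea_gen (lie_bracket x\<^sub>p x\<^sub>q) * (P * u)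
    - uea_scalar (ch x\<^sub>q) * (X * (P * u)) - uea_scalar (cf x\<^sub>q) * (X * (Q * u))
    - uea_scalar (ce x\<^sub>q) * (Y * (P * u)) + uea_scalar (ch x\<^sub>q) * (Y * (Q * u))"
  unfolding euler_def p_commute[OF dual_sl2(2), folded Y_def] q_commute[OF dual_sl2(2), folded Y_def]
  by (simp add: dual_q uea_scalar_one uea_gen_bracket uea_scalar_left_commute algebra_simps
      flip: X_def Y_def)

text \<open>Euler's identity for homogeneous forms, up to lower order. On passing from \<open>u\<close> to \<open>X u\<close>
  the commutator \<open>[P, X] = 1\<close> raises the eigenvalue by one; the
  remaining terms of \<open>euler_commute_X\<close>, apart from \<open>X\<close> times the Euler operator of \<open>u\<close>, consist
  of a single factor from \<open>\<ss>\<ll>\<^sub>2\<close> in front of \<open>P u\<close> or \<open>Q u\<close>, and so have lower degree than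
  \<open>X u\<close>.\<close>

lemma F_euler: "F n u \<Longrightarrow> F (n - 1) (euler u - uea_scalar (of_nat (n - 1)) * u)"
proof (induction rule: F.induct)
  case (J u n)
  then show ?case by (intro F.J J_diff euler_J J_mult)
next
  case (poly n c)
  have "F n (uea_scalar (of_nat n) * uea_poly c C)"
    by (cases n) (auto intro: F.J J_zero F_scalar F.poly)
  then show ?case using euler_poly by (auto intro: F_diff F.J)
next
  case (add n u v)
  then show ?case using F.add by (fastforce simp: euler_add algebra_simps)
next
  case (X n u)
  show ?case
  proof (cases n)
    case 0
    then show ?thesis using X F_zero by (simp add: F.J J_diff J_mult euler_J)
  next
    case (Suc m)
    then have "F m (P * u)" "F m (Q * u)" using F_PQ[OF X.hyps] by auto
    moreover have "euler (X * u) - uea_scalar (of_nat n) * (X * u)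
      = X * (euler u - uea_scalar (of_nat m) * u) + uea_gen (lie_bracket x\<^sub>q x\<^sub>p) * (Q * u)
        - uea_scalar (ch x\<^sub>p) * (X * (P * u)) - uea_scalar (cf x\<^sub>p) * (X * (Q * u))
        - uea_scalar (ce x\<^sub>p) * (Y * (P * u)) + uea_scalar (ch x\<^sub>p) * (Y * (Q * u))"
      by (simp add: Suc euler_commute_X algebra_simps uea_scalar_add uea_scalar_one
          uea_scalar_left_commute)
    ultimately show ?thesis
      using X.IH by (auto simp: Suc intro!: F_closure F.X F.Y F_sl2 sl2_bracket dual_sl2)
  qed
next
  case (Y n u)
  show ?case
  proof (cases n)
    case 0
    then show ?thesis using Y F_zero by (simp add: F.J J_diff J_mult euler_J)
  next
    case (Suc m)
    then have "F m (P * u)" "F m (Q * u)" using F_PQ[OF Y.hyps] by auto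
    moreover have "euler (Y * u) - uea_scalar (of_nat n) * (Y * u)
      = Y * (euler u - uea_scalar (of_nat m) * u) + uea_gen (lie_bracket x\<^sub>p x\<^sub>q) * (P * u)
        - uea_scalar (ch x\<^sub>q) * (X * (P * u)) - uea_scalar (cf x\<^sub>q) * (X * (Q * u))
        - uea_scalar (ce x\<^sub>q) * (Y * (P * u)) + uea_scalar (ch x\<^sub>q) * (Y * (Q * u))"
      by (simp add: Suc euler_commute_Y algebra_simps uea_scalar_add uea_scalar_one
          uea_scalar_left_commute)
    ultimately show ?thesis
      using Y.IH by (auto simp: Suc intro!: F_closure F.X F.Y F_sl2 sl2_bracket dual_sl2)
  qed
qed

text \<open>The union of the filtration contains the scalars and is stable under left multiplication by
  every generator. For \<open>z\<close> this holds because \<open>z = [p, q] = [P, Q]\<close>.\<close>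

lemma F_exhaustive: "\<exists>n. F n u"
proof (induction u rule: uea_induct)
  case (scalar c)
  show ?case using F.poly[of 0 "[:c:]"] by (auto simp: uea_poly_pCons uea_poly_zero)
next
  case (add u v)
  then obtain m n where "F m u" "F n v" by blast
  then have "F (max m n) u" "F (max m n) v" by (auto intro: F_mono[rotated])
  then show ?case by (blast intro: F.add)
next
  case (gen x u)
  then obtain n where n: "F n u" by blast
  have down: "F n (P * v) \<and> F n (Q * v)" if "F n v" for v
    using F_PQ[OF that] by (auto intro: F_mono[of "n - 1"])
  let ?y = "Schroedinger (ce x) (ch x) (cf x) 0 0 0"
  have "x = ?y + cp x *\<^sub>L sch_p + cq x *\<^sub>L sch_q + cz x *\<^sub>L lie_bracket sch_p sch_q"
    by (cases x) (simp add: schroedinger_defs)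
  then have "uea_gen x
      = uea_gen (?y + cp x *\<^sub>L sch_p + cq x *\<^sub>L sch_q + cz x *\<^sub>L lie_bracket sch_p sch_q)"
    by (rule arg_cong)
  also have "\<dots> = uea_gen ?y + uea_scalar (cp x) * (P + uea_scalar a)
      + uea_scalar (cq x) * (Q + uea_scalar b) + uea_scalar (cz x) * (P * Q - Q * P)"
    by (simp add: uea_gen_add uea_gen_scale uea_gen_bracket P_def Q_def algebra_simps
        uea_scalar_gen uea_scalar_commute[of a "uea_scalar b"])
  finally have gen_x: "uea_gen x = \<dots>" .
  have "uea_gen x * u = uea_gen ?y * u
      + uea_scalar (cp x) * (P * u + uea_scalar a * u)
      + uea_scalar (cq x) * (Q * u + uea_scalar b * u)
      + uea_scalar (cz x) * (P * (Q * u) - Q * (P * u))"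
    by (subst gen_x) (simp only: distrib_left distrib_right left_diff_distrib mult.assoc)
  moreover have "F (Suc n) (uea_gen ?y * u)"
    using n by (intro F_sl2) (simp_all add: sl2_def)
  moreover have "F (Suc n) u" "F (Suc n) (P * u)" "F (Suc n) (Q * u)"
    "F (Suc n) (P * (Q * u))" "F (Suc n) (Q * (P * u))"
    using n down by (blast intro: F_Suc)+
  ultimately have "F (Suc n) (uea_gen x * u)"
    by (simp only:) (intro F_closure; assumption)
  then show ?case by blast
qed

text \<open>If \<open>P u\<close> and \<open>Q u\<close> lie in \<open>J\<close>, then so does \<open>euler u\<close>. Hence \<open>d u\<close> has degree less than
  \<open>d\<close> whenever \<open>u\<close> has degree at most \<open>d\<close>, and as \<open>d\<close> is invertible for \<open>d > 0\<close>, the degree of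
  \<open>u\<close> can be lowered to \<open>0\<close>.\<close>

theorem PQ_kernel:
  assumes "P * u \<in> J" "Q * u \<in> J"
  obtains c j where "j \<in> J" "u = uea_poly c C + j"
proof -
  have "F (Suc n) u \<Longrightarrow> F (Suc 0) u" for n
  proof (induction n)
    case (Suc n)
    let ?c = "of_nat (Suc n) :: complex"
    have "F (Suc n) (euler u)"
      using assms by (auto simp: euler_def intro: F.J J_add J_mult)
    moreover have "F (Suc n) (euler u - uea_scalar ?c * u)"
      using F_euler[OF Suc.prems] by simp
    ultimately have "F (Suc n) (euler u - (euler u - uea_scalar ?c * u))"
      by (rule F_diff)
    then have "F (Suc n) (uea_scalar ?c * u)"
      by simp
    then have "F (Suc n) (uea_scalar (1 / ?c) * (uea_scalar ?c * u))"
      by (rule F_scalar)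
    moreover have "uea_scalar (1 / ?c) * (uea_scalar ?c * u) = u"
      by (simp add: uea_scalar_one del: of_nat_Suc flip: mult.assoc uea_scalar_mult)
    ultimately show ?case using Suc.IH by simp
  qed
  moreover obtain n where "F n u" using F_exhaustive by blast
  ultimately have "F (Suc 0) u" using F_Suc by blast
  then show ?thesis using F_one that by blast
qed

end


section \<open>The annihilator of the cyclic vector\<close>

lemma tensor_diff_left:
  "frag_of (u - v, c) - (frag_of (u, c) - frag_of (v, c)) \<in> group_closure (tensor_relations j act)"
proof -
  have "frag_of (u - v + v, c) - (frag_of (u - v, c) + frag_of (v, c))
      \<in> group_closure (tensor_relations j act)"
    by (rule group_closure.base) (unfold tensor_relations_def, blast)
  then show ?thesis
    using group_closure_minus_iff by (fastforce simp: algebra_simps)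
qed

lemma tensor_eq_iff:
  "tensor j act u c = tensor j act v c
    \<longleftrightarrow> tensor j act (u - v) c = mzero (extension_module j act)"
proof -
  let ?G = "group_closure (tensor_relations j act)"
  have "frag_of (u, c) - frag_of (v, c) \<in> ?G \<longleftrightarrow> frag_of (u - v, c) \<in> ?G"
    using group_closure_add[OF tensor_diff_left, of "frag_of (u, c) - frag_of (v, c)" j act u v c]
      group_closure.diff[OF _ tensor_diff_left, of "frag_of (u - v, c)" j act u v c] by auto
  then show ?thesis
    by (simp add: tensor_def extension_zero extension_eq_iff)
qed

lemma smult_cyclic_eq_iff:
  fixes \<phi> :: "heisenberg \<Rightarrow> complex"
  defines "M \<equiv> quasi_whittaker_module \<phi>" and "w \<equiv> cyclic_vector \<phi>"
  shows "msmult M u w = msmult M v w \<longleftrightarrow> msmult M (u - v) w = mzero M"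
  unfolding M_def w_def quasi_whittaker_module_def cyclic_vector_def tensor_smult mult_1_right
  by (rule tensor_eq_iff)

text \<open>A pure tensor \<open>u \<otimes> c\<close> equals \<open>u c \<otimes> 1\<close>, since the scalar \<open>c\<close> belongs to \<open>U(\<H>)\<close>.\<close>

lemma cyclic_vector_generates:
  fixes \<phi> :: "heisenberg \<Rightarrow> complex"
  assumes hom: "lie_hom \<phi>" and m: "m \<in> mcarrier (quasi_whittaker_module \<phi>)"
  obtains u where "m = msmult (quasi_whittaker_module \<phi>) u (cyclic_vector \<phi>)"
proof -
  interpret c: uea_data id \<phi>
    by (rule uea_data_character) (rule hom)
  let ?j = "uea_map heis_incl" and ?act = "character_act \<phi>"
  obtain x where x: "m = tensor_equiv ?j ?act `` {x}"
    using m by (auto simp: quasi_whittaker_module_def extension_carrier)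
  have "\<exists>u. tensor_equiv ?j ?act `` {x} = tensor_equiv ?j ?act `` {frag_of (u, 1)}"
  proof (induction x rule: frag_induction[OF subset_UNIV])
    case 1
    have "tensor ?j ?act 0 1 = mzero (extension_module ?j ?act)"
      using tensor_eq_iff[of ?j ?act 0 1 0] by simp
    then show ?case by (auto simp: extension_zero tensor_def intro!: exI[of _ 0])
  next
    case (2 y)
    obtain u c where y: "y = (u, c)" by fastforce
    have "tensor ?j ?act u c = tensor ?j ?act (u * ?j (uea_scalar c)) 1"
      unfolding tensor_balanced by (simp add: character_act_def c.uea_lift_scalar)
    then show ?case unfolding y tensor_def by blast
  next
    case (3 y z)
    then obtain u v where uv: "tensor_equiv ?j ?act `` {y} = tensor_equiv ?j ?act `` {frag_of (u, 1)}"
      "tensor_equiv ?j ?act `` {z} = tensor_equiv ?j ?act `` {frag_of (v, 1)}" by blast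
    let ?G = "group_closure (tensor_relations ?j ?act)"
    have "(y - frag_of (u, 1)) - (z - frag_of (v, 1))
        - (frag_of (u - v, 1) - (frag_of (u, 1) - frag_of (v, 1))) \<in> ?G"
      using uv unfolding extension_eq_iff
      by (intro group_closure.diff[OF group_closure.diff tensor_diff_left])
    then show ?case unfolding extension_eq_iff
      by (intro exI[of _ "u - v"]) (simp add: algebra_simps)
  qed
  then obtain u where "m = tensor ?j ?act u 1" using x by (auto simp: tensor_def)
  then show ?thesis
    by (intro that[of u])
      (simp add: quasi_whittaker_module_def cyclic_vector_def tensor_smult)
qed

text \<open>A character vanishes on the commutator \<open>z = [p, q]\<close>.\<close>

lemma character_determined_by_p_q:
  fixes \<phi> :: "heisenberg \<Rightarrow> complex"
  assumes hom: "lie_hom \<phi>" and "\<phi> heis_p = 0" and "\<phi> heis_q = 0"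
  shows "\<phi> x = 0"
proof -
  have linear: "\<phi> (y + y') = \<phi> y + \<phi> y'" "\<phi> (c *\<^sub>L y) = c * \<phi> y"
    and bracket: "\<phi> (lie_bracket y y') = 0" for c y y'
    using hom by (simp_all add: lie_hom_def lie_scale_complex_def lie_bracket_complex_def)
  have "heis_z = lie_bracket heis_p heis_q"
    by transfer (simp add: schroedinger_brackets)
  then have z: "\<phi> heis_z = 0"
    using bracket[of heis_p heis_q] by metis
  let ?y = "heis_incl x"
  have "ce ?y = 0 \<and> ch ?y = 0 \<and> cf ?y = 0"
    using heis_incl[of x] by (simp only: heisenberg_span_iff)
  then have "?y = cp ?y *\<^sub>L sch_p + cq ?y *\<^sub>L sch_q + cz ?y *\<^sub>L sch_z"
    by (cases ?y) (simp add: schroedinger_defs)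
  then have "x = cp ?y *\<^sub>L heis_p + cq ?y *\<^sub>L heis_q + cz ?y *\<^sub>L heis_z"
    by (simp only: plus_heisenberg.rep_eq lie_scale_heisenberg.rep_eq
        heis_p.rep_eq heis_q.rep_eq heis_z.rep_eq flip: heis_incl_inject)
  then have "\<phi> x = \<phi> (cp ?y *\<^sub>L heis_p + cq ?y *\<^sub>L heis_q + cz ?y *\<^sub>L heis_z)"
    by (rule arg_cong[where f = \<phi>])
  also have "\<dots> = 0"
    by (simp add: linear z assms)
  finally show ?thesis .
qed

lemma C_elem_eq_gen: "C_elem \<phi> = uea_gen (C_vec (\<phi> heis_p) (\<phi> heis_q))"
proof -
  let ?a = "\<phi> heis_p" and ?b = "\<phi> heis_q"
  have "C_vec ?a ?b = ?a\<^sup>2 *\<^sub>L sch_f + (- ?b\<^sup>2) *\<^sub>L sch_e + (- (?a * ?b)) *\<^sub>L sch_h"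
    by (simp add: C_vec_def schroedinger_defs)
  then have "uea_gen (C_vec ?a ?b)
      = uea_gen (?a\<^sup>2 *\<^sub>L sch_f + (- ?b\<^sup>2) *\<^sub>L sch_e + (- (?a * ?b)) *\<^sub>L sch_h)"
    by (rule arg_cong)
  then show ?thesis
    unfolding C_elem_def uea_gen_add uea_gen_scale uea_scalar_minus by simp
qed

theorem proposition3p7:
  fixes \<phi> :: "heisenberg \<Rightarrow> complex"
    and w' :: "(schroedinger uea \<times> complex \<Rightarrow>\<^sub>0 int) set"
  assumes "lie_hom \<phi>" and "\<phi> \<noteq> (\<lambda>x. 0)"
    and "quasi_whittaker_vector \<phi> (quasi_whittaker_module \<phi>) w'"
  shows "w' \<in> {msmult (quasi_whittaker_module \<phi>) (uea_poly a (C_elem \<phi>)) (cyclic_vector \<phi>)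
                | a :: complex poly. True}"
proof -
  let ?M = "quasi_whittaker_module \<phi>" and ?w = "cyclic_vector \<phi>"
  let ?a = "\<phi> heis_p" and ?b = "\<phi> heis_q"
  define J where "J = {u. msmult ?M u ?w = mzero ?M}"
  interpret M: left_module ?M
    unfolding quasi_whittaker_module_def by (rule left_module_extension)
  note w = cyclic_vector_carrier[of \<phi>]
  have J_iff: "u - v \<in> J \<longleftrightarrow> msmult ?M u ?w = msmult ?M v ?w" for u v
    using smult_cyclic_eq_iff[of \<phi>] by (simp add: J_def)
  have nontrivial: "?a \<noteq> 0 \<or> ?b \<noteq> 0"
  proof (rule ccontr)
    assume "\<not> (?a \<noteq> 0 \<or> ?b \<noteq> 0)"
    then have "\<phi> = (\<lambda>x. 0)"
      using character_determined_by_p_q[OF assms(1)] by (intro ext) simp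
    with assms(2) show False ..
  qed
  have J_whittaker: "uea_gen (heis_incl x) - uea_scalar (\<phi> x) \<in> J" for x
    unfolding J_iff by (rule cyclic_vector_quasi_whittaker) fact
  obtain x y where xy: "x \<in> sl2" "y \<in> sl2" "p_form ?a ?b x = 1" "q_form ?a ?b x = 0"
    "p_form ?a ?b y = 0" "q_form ?a ?b y = 1"
    by (rule dual_vectors_exist[OF nontrivial])
  interpret quasi_whittaker_annihilator ?a ?b J x y
  proof
    fix u v
    have smult_zero: "msmult ?M v (mzero ?M) = mzero ?M"
      by (simp add: quasi_whittaker_module_def extension_zero extension_smult tensor_lmult_def)
    show "v * u \<in> J" if "u \<in> J"
      using that smult_zero by (simp add: J_def M.smult_assoc[OF w])
    show "u + v \<in> J" if "u \<in> J" "v \<in> J"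
      using that by (simp add: J_def M.smult_add_left[OF w] M.add_zero[OF M.zero_closed])
    show "uea_gen sch_p - uea_scalar ?a \<in> J" "uea_gen sch_q - uea_scalar ?b \<in> J"
      using J_whittaker[of heis_p] J_whittaker[of heis_q]
      by (simp_all add: heis_p.rep_eq heis_q.rep_eq)
  qed (fact nontrivial xy)+
  have w': "w' \<in> mcarrier ?M"
    "\<And>x. msmult ?M (uea_gen (heis_incl x)) w' = msmult ?M (uea_scalar (\<phi> x)) w'"
    using assms(3) by (auto simp: quasi_whittaker_vector_def)
  obtain u where u: "w' = msmult ?M u ?w"
    using cyclic_vector_generates[OF assms(1) w'(1)] .
  have kernel: "(uea_gen (heis_incl x) - uea_scalar (\<phi> x)) * u \<in> J" for x
    using w'(2)[of x] by (simp add: left_diff_distrib J_iff M.smult_assoc[OF w] u)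
  have "P * u \<in> J" "Q * u \<in> J"
    using kernel[of heis_p] kernel[of heis_q]
    by (simp_all add: P_def Q_def heis_p.rep_eq heis_q.rep_eq)
  then obtain c j where cj: "j \<in> J" "u = uea_poly c C + j"
    by (rule PQ_kernel)
  then have "u - uea_poly c C \<in> J" by simp
  then have "w' = msmult ?M (uea_poly c (C_elem \<phi>)) ?w"
    unfolding J_iff u C_def C_elem_eq_gen .
  then show ?thesis by blast
qed

end
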